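(* Let $A$ be an associative algebra over $\mathbb{K}=\mathbb{R}$ or $\mathbb{C}$ with a unit. Then one has canonically $\underline{\Omega}^1_{\mathrm{Der}}(A)=(\Omega^1_{\mathrm{Der}}(A))^{\ast_A\ast_A}$. More precisely: (a) $(\Omega^1_{\mathrm{Der}}(A))^{\ast_A}=\mathrm{Der}(A)$ canonically, i.e. the map $X\mapsto i_X$, $i_X(\omega)=\omega(X)$ for $\omega\in\Omega^1_{\mathrm{Der}}(A)$, is an isomorphism of $Z(A)$-modules from $\mathrm{Der}(A)$ onto $\mathrm{Hom}^A_A(\Omega^1_{\mathrm{Der}}(A),A)$; and the duality $\langle\omega,X\rangle=\omega(X)$ between the central bimodule $\Omega^1_{\mathrm{Der}}(A)$ and the $Z(A)$-module $\mathrm{Der}(A)$ is separated. (b) $(\mathrm{Der}(A))^{\ast_A}=\underline{\Omega}^1_{\mathrm{Der}}(A)$ canonically (as $A$-bimodules); and the duality $\langle\omega,X\rangle=\omega(X)$ between the central bimodule $\underline{\Omega}^1_{\mathrm{Der}}(A)$ and the $Z(A)$-module $\mathrm{Der}(A)$ is separated. The identification $(\Omega^1_{\mathrm{Der}}(A))^{\ast_A\ast_A}=\underline{\Omega}^1_{\mathrm{Der}}(A)$ is the one obtained by combining the identifications of (a) and (b).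
   Context: $Z(A)$ denotes the center of $A$. $\mathrm{Der}(A)$ is the Lie algebra of all $\mathbb{K}$-linear derivations of $A$ into itself; it is a $Z(A)$-module via $(zX)(a)=zX(a)$. $C(\mathrm{Der}(A),A)$ is the graded differential algebra of Chevalley–Eilenberg cochains of the Lie algebra $\mathrm{Der}(A)$ with values in the $\mathrm{Der}(A)$-module $A$: its degree-$n$ elements are the antisymmetric $\mathbb{K}$-multilinear maps $\mathrm{Der}(A)^n\to A$, its degree-$0$ part is $A$, the product is the antisymmetrized product induced by that of $A$, and $d$ is the Chevalley–Eilenberg differential; in particular $(da)(X)=X(a)$ for $a\in A$, $X\in\mathrm{Der}(A)$. In degree one the $A$-bimodule structure is $(a\omega b)(X)=a\,\omega(X)\,b$. $\Omega_{\mathrm{Der}}(A)$ is the smallest differential subalgebra of $C(\mathrm{Der}(A),A)$ containing $A$, and $\Omega^1_{\mathrm{Der}}(A)$ is its degree-one part (i.e. the sub-$A$-bimodule of linear maps $\mathrm{Der}(A)\to A$ generated by the $da$, $a\in A$). $\underline{\Omega}_{\mathrm{Der}}(A)$ is the differential subalgebra of $C(\mathrm{Der}(A),A)$ consisting of all $Z(A)$-multilinear cochains, and $\underline{\Omega}^1_{\mathrm{Der}}(A)$ is its degree-one part. An $A$-bimodule $M$ is central if $zm=mz$ for all $z\in Z(A)$, $m\in M$. For $A$-bimodules $M,M'$, $\mathrm{Hom}^A_A(M,M')$ denotes the space of $A$-bimodule homomorphisms. For a central $A$-bimodule $M$, its dual is the $Z(A)$-module $M^{\ast_A}=\mathrm{Hom}^A_A(M,A)$,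 with $(z\mu)(m)=z\mu(m)$. For a $Z(A)$-module $N$, its dual is the $A$-bimodule $N^{\ast_A}=\mathrm{Hom}_{Z(A)}(N,A)$, with $(a\nu b)(n)=a\,\nu(n)\,b$. Thus $M^{\ast_A\ast_A}=\mathrm{Hom}_{Z(A)}(M^{\ast_A},A)$. A duality between a central $A$-bimodule $M$ and a $Z(A)$-module $N$ is an $A$-bimodule homomorphism $M\otimes_{Z(A)}N\to A$, $m\otimes n\mapsto\langle m,n\rangle$. It is separated if both of the following hold: $\langle m,n\rangle=0$ for all $n\in N$ implies $m=0$; and $\langle m,n\rangle=0$ for all $m\in M$ implies $n=0$. *)

theory Defs
  imports
    Complex_Main
    "HOL-Library.Function_Algebras"
    "HOL-Combinatorics.Combinatorics"
begin

text \<open>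
  The ground field is a field isomorphic to that of the real or of the complex numbers; the
  class has \<^typ>\<open>real\<close> and \<^typ>\<open>complex\<close> as instances.
\<close>

class real_or_complex = field_char_0 +
  assumes real_or_complex:
    "(\<exists>\<phi> :: 'a \<Rightarrow> real. bij \<phi> \<and> (\<forall>x y. \<phi> (x + y) = \<phi> x + \<phi> y \<and> \<phi> (x * y) = \<phi> x * \<phi> y)) \<or>
     (\<exists>\<phi> :: 'a \<Rightarrow> complex. bij \<phi> \<and> (\<forall>x y. \<phi> (x + y) = \<phi> x + \<phi> y \<and> \<phi> (x * y) = \<phi> x * \<phi> y))"

instance real :: real_or_complex
  by standard (rule disjI1, rule exI[of _ id], simp)

instance complex :: real_or_complex
  by standard (rule disjI2, rule exI[of _ id], simp)

text \<open>
  The sort \<open>{ring, monoid_mult}\<close> is used for the algebra instead of \<open>ring_1\<close> because the latter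
  excludes the zero algebra.
\<close>

locale unital_algebra = vector_space scale
  for scale :: "'k::field \<Rightarrow> 'a::{ring, monoid_mult} \<Rightarrow> 'a" +
  assumes scale_mult_left: "scale c (x * y) = scale c x * y"
    and scale_mult_right: "scale c (x * y) = x * scale c y"

definition center :: "'a::times set"
  where "center = {z. \<forall>a. z * a = a * z}"

text \<open>
  Every module below except the algebra itself is a set of algebra-valued functions, with addition
  taken from \<^theory>\<open>HOL-Library.Function_Algebras\<close> and the following actions.
\<close>

definition lmul :: "'a::times \<Rightarrow> ('x \<Rightarrow> 'a) \<Rightarrow> 'x \<Rightarrow> 'a"
  where "lmul a f = (\<lambda>x. a * f x)"

definition rmul :: "('x \<Rightarrow> 'a::times) \<Rightarrow> 'a \<Rightarrow> 'x \<Rightarrow> 'a"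
  where "rmul f a = (\<lambda>x. f x * a)"


subsection \<open>Modules over the center, bimodules and dualities\<close>

locale zmodule =
  fixes N :: "'n::ab_group_add set"
    and act :: "'a::{ring, monoid_mult} \<Rightarrow> 'n \<Rightarrow> 'n"
  assumes zero_closed: "0 \<in> N"
    and add_closed: "m \<in> N \<Longrightarrow> n \<in> N \<Longrightarrow> m + n \<in> N"
    and uminus_closed: "n \<in> N \<Longrightarrow> - n \<in> N"
    and act_closed: "z \<in> center \<Longrightarrow> n \<in> N \<Longrightarrow> act z n \<in> N"
    and act_add_right: "z \<in> center \<Longrightarrow> m \<in> N \<Longrightarrow> n \<in> N \<Longrightarrow> act z (m + n) = act z m + act z n"
    and act_add_left: "z \<in> center \<Longrightarrow> w \<in> center \<Longrightarrow> n \<in> N \<Longrightarrow> act (z + w) n = act z n + act w n"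
    and act_mult: "z \<in> center \<Longrightarrow> w \<in> center \<Longrightarrow> n \<in> N \<Longrightarrow> act (z * w) n = act z (act w n)"
    and act_one: "n \<in> N \<Longrightarrow> act 1 n = n"

text \<open>
  No compatibility with the ground field is assumed for bimodules: on central bimodules both
  actions of the scalar multiples of 1 agree, since these are central.
\<close>

locale bimodule =
  fixes M :: "'m::ab_group_add set"
    and l :: "'a::{ring, monoid_mult} \<Rightarrow> 'm \<Rightarrow> 'm"
    and r :: "'m \<Rightarrow> 'a \<Rightarrow> 'm"
  assumes zero_closed: "0 \<in> M"
    and add_closed: "m \<in> M \<Longrightarrow> n \<in> M \<Longrightarrow> m + n \<in> M"
    and uminus_closed: "m \<in> M \<Longrightarrow> - m \<in> M"
    and l_closed: "m \<in> M \<Longrightarrow> l a m \<in> M"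
    and l_add_right: "m \<in> M \<Longrightarrow> n \<in> M \<Longrightarrow> l a (m + n) = l a m + l a n"
    and l_add_left: "m \<in> M \<Longrightarrow> l (a + b) m = l a m + l b m"
    and l_mult: "m \<in> M \<Longrightarrow> l (a * b) m = l a (l b m)"
    and l_one: "m \<in> M \<Longrightarrow> l 1 m = m"
    and r_closed: "m \<in> M \<Longrightarrow> r m a \<in> M"
    and r_add_left: "m \<in> M \<Longrightarrow> n \<in> M \<Longrightarrow> r (m + n) a = r m a + r n a"
    and r_add_right: "m \<in> M \<Longrightarrow> r m (a + b) = r m a + r m b"
    and r_mult: "m \<in> M \<Longrightarrow> r m (a * b) = r (r m a) b"
    and r_one: "m \<in> M \<Longrightarrow> r m 1 = m"
    and l_r: "m \<in> M \<Longrightarrow> r (l a m) b = l a (r m b)"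

locale central_bimodule = bimodule M l r
  for M :: "'m::ab_group_add set"
    and l :: "'a::{ring, monoid_mult} \<Rightarrow> 'm \<Rightarrow> 'm"
    and r :: "'m \<Rightarrow> 'a \<Rightarrow> 'm" +
  assumes central: "z \<in> center \<Longrightarrow> m \<in> M \<Longrightarrow> l z m = r m z"

definition zmodule_hom ::
  "'n::ab_group_add set \<Rightarrow> ('a::{ring, monoid_mult} \<Rightarrow> 'n \<Rightarrow> 'n) \<Rightarrow>
   'p::ab_group_add set \<Rightarrow> ('a \<Rightarrow> 'p \<Rightarrow> 'p) \<Rightarrow> ('n \<Rightarrow> 'p) \<Rightarrow> bool"
  where "zmodule_hom N act N' act' f \<longleftrightarrow>
    f ` N \<subseteq> N' \<and>
    (\<forall>m\<in>N. \<forall>n\<in>N. f (m + n) = f m + f n) \<and>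
    (\<forall>z\<in>center. \<forall>n\<in>N. f (act z n) = act' z (f n))"

definition zmodule_iso ::
  "'n::ab_group_add set \<Rightarrow> ('a::{ring, monoid_mult} \<Rightarrow> 'n \<Rightarrow> 'n) \<Rightarrow>
   'p::ab_group_add set \<Rightarrow> ('a \<Rightarrow> 'p \<Rightarrow> 'p) \<Rightarrow> ('n \<Rightarrow> 'p) \<Rightarrow> bool"
  where "zmodule_iso N act N' act' f \<longleftrightarrow>
    zmodule N act \<and> zmodule N' act' \<and> zmodule_hom N act N' act' f \<and> bij_betw f N N'"

definition bimodule_hom ::
  "'m::ab_group_add set \<Rightarrow> ('a::{ring, monoid_mult} \<Rightarrow> 'm \<Rightarrow> 'm) \<Rightarrow> ('m \<Rightarrow> 'a \<Rightarrow> 'm) \<Rightarrow>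
   'p::ab_group_add set \<Rightarrow> ('a \<Rightarrow> 'p \<Rightarrow> 'p) \<Rightarrow> ('p \<Rightarrow> 'a \<Rightarrow> 'p) \<Rightarrow> ('m \<Rightarrow> 'p) \<Rightarrow> bool"
  where "bimodule_hom M l r M' l' r' f \<longleftrightarrow>
    f ` M \<subseteq> M' \<and>
    (\<forall>m\<in>M. \<forall>n\<in>M. f (m + n) = f m + f n) \<and>
    (\<forall>a. \<forall>m\<in>M. f (l a m) = l' a (f m) \<and> f (r m a) = r' (f m) a)"

definition bimodule_iso ::
  "'m::ab_group_add set \<Rightarrow> ('a::{ring, monoid_mult} \<Rightarrow> 'm \<Rightarrow> 'm) \<Rightarrow> ('m \<Rightarrow> 'a \<Rightarrow> 'm) \<Rightarrow>
   'p::ab_group_add set \<Rightarrow> ('a \<Rightarrow> 'p \<Rightarrow> 'p) \<Rightarrow> ('p \<Rightarrow> 'a \<Rightarrow> 'p) \<Rightarrow> ('m \<Rightarrow> 'p) \<Rightarrow> bool"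
  where "bimodule_iso M l r M' l' r' f \<longleftrightarrow>
    bimodule M l r \<and> bimodule M' l' r' \<and> bimodule_hom M l r M' l' r' f \<and> bij_betw f M M'"

text \<open>
  Homomorphisms are total functions on a type, so elements of the duals are normalised to
  vanish outside the module; equality of functions is then equality on the module.
\<close>

definition bimodule_dual ::
  "'m::ab_group_add set \<Rightarrow> ('a::{ring, monoid_mult} \<Rightarrow> 'm \<Rightarrow> 'm) \<Rightarrow> ('m \<Rightarrow> 'a \<Rightarrow> 'm) \<Rightarrow> ('m \<Rightarrow> 'a) set"
  where "bimodule_dual M l r =
    {\<mu>. bimodule_hom M l r UNIV (*) (*) \<mu> \<and> (\<forall>m. m \<notin> M \<longrightarrow> \<mu> m = 0)}"

definition zmodule_dual ::
  "'n::ab_group_add set \<Rightarrow> ('a::{ring, monoid_mult} \<Rightarrow> 'n \<Rightarrow> 'n) \<Rightarrow> ('n \<Rightarrow> 'a) set"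
  where "zmodule_dual N act =
    {\<nu>. zmodule_hom N act UNIV (*) \<nu> \<and> (\<forall>n. n \<notin> N \<longrightarrow> \<nu> n = 0)}"

definition pullback_on :: "'p set \<Rightarrow> ('p \<Rightarrow> 'n) \<Rightarrow> ('n \<Rightarrow> 'a::zero) \<Rightarrow> 'p \<Rightarrow> 'a"
  where "pullback_on P g \<nu> = (\<lambda>p. if p \<in> P then \<nu> (g p) else 0)"

text \<open>
  A bimodule homomorphism from the tensor product of \<open>M\<close> and \<open>N\<close> over the center to the algebra
  is given, through the universal property, as a biadditive balanced map that is
  bilinear for the bimodule structure of \<open>M\<close>.
\<close>

locale duality = M: central_bimodule M l r + N: zmodule N act
  for M :: "'m::ab_group_add set"
    and l :: "'a::{ring, monoid_mult} \<Rightarrow> 'm \<Rightarrow> 'm"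
    and r :: "'m \<Rightarrow> 'a \<Rightarrow> 'm"
    and N :: "'n::ab_group_add set"
    and act :: "'a \<Rightarrow> 'n \<Rightarrow> 'n" +
  fixes p :: "'m \<Rightarrow> 'n \<Rightarrow> 'a"
  assumes add_left: "m \<in> M \<Longrightarrow> m' \<in> M \<Longrightarrow> n \<in> N \<Longrightarrow> p (m + m') n = p m n + p m' n"
    and add_right: "m \<in> M \<Longrightarrow> n \<in> N \<Longrightarrow> n' \<in> N \<Longrightarrow> p m (n + n') = p m n + p m n'"
    and balanced: "z \<in> center \<Longrightarrow> m \<in> M \<Longrightarrow> n \<in> N \<Longrightarrow> p (r m z) n = p m (act z n)"
    and left_linear: "m \<in> M \<Longrightarrow> n \<in> N \<Longrightarrow> p (l a m) n = a * p m n"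
    and right_linear: "m \<in> M \<Longrightarrow> n \<in> N \<Longrightarrow> p (r m a) n = p m n * a"

locale separated_duality = duality +
  assumes separated_left: "m \<in> M \<Longrightarrow> (\<And>n. n \<in> N \<Longrightarrow> p m n = 0) \<Longrightarrow> m = 0"
    and separated_right: "n \<in> N \<Longrightarrow> (\<And>m. m \<in> M \<Longrightarrow> p m n = 0) \<Longrightarrow> n = 0"


subsection \<open>Derivations and Chevalley--Eilenberg cochains\<close>

definition Der :: "('k::field \<Rightarrow> 'a::{ring, monoid_mult} \<Rightarrow> 'a) \<Rightarrow> ('a \<Rightarrow> 'a) set"
  where "Der scale =
    {X. Vector_Spaces.linear scale scale X \<and> (\<forall>a b. X (a * b) = X a * b + a * X b)}"

definition lie :: "('a::ab_group_add \<Rightarrow> 'a) \<Rightarrow> ('a \<Rightarrow> 'a) \<Rightarrow> 'a \<Rightarrow> 'a"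
  where "lie X Y = X \<circ> Y - Y \<circ> X"

text \<open>
  A cochain of degree \<open>n\<close> is a function of the list of its \<open>n\<close> arguments, normalised to vanish
  on all lists that are not lists of \<open>n\<close> derivations.
\<close>

definition Der_args :: "('k::field \<Rightarrow> 'a::{ring, monoid_mult} \<Rightarrow> 'a) \<Rightarrow> nat \<Rightarrow> ('a \<Rightarrow> 'a) list set"
  where "Der_args scale n = {Xs. length Xs = n \<and> set Xs \<subseteq> Der scale}"

definition cochains ::
  "('k::field \<Rightarrow> 'a::{ring, monoid_mult} \<Rightarrow> 'a) \<Rightarrow> nat \<Rightarrow> (('a \<Rightarrow> 'a) list \<Rightarrow> 'a) set"
  where "cochains scale n = {\<omega>.
    (\<forall>Xs. Xs \<notin> Der_args scale n \<longrightarrow> \<omega> Xs = 0) \<and>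
    (\<forall>Xs \<in> Der_args scale n. \<forall>i<n. \<forall>X \<in> Der scale. \<forall>Y \<in> Der scale.
       \<omega> (Xs[i := X + Y]) = \<omega> (Xs[i := X]) + \<omega> (Xs[i := Y])) \<and>
    (\<forall>Xs \<in> Der_args scale n. \<forall>i<n. \<forall>X \<in> Der scale. \<forall>c.
       \<omega> (Xs[i := (\<lambda>a. scale c (X a))]) = scale c (\<omega> (Xs[i := X]))) \<and>
    (\<forall>Xs \<in> Der_args scale n. \<forall>\<sigma>. \<sigma> permutes {..<n} \<longrightarrow>
       \<omega> (permute_list \<sigma> Xs) = scale (of_int (sign \<sigma>)) (\<omega> Xs))}"

text \<open>The algebra as the degree 0 part of the cochains.\<close>

definition cochain0 :: "'a::zero \<Rightarrow> ('a \<Rightarrow> 'a) list \<Rightarrow> 'a"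
  where "cochain0 a = (\<lambda>Xs. if Xs = [] then a else 0)"

text \<open>
  The factor \<open>1 / (m! n!)\<close> (equivalently, summation over shuffles) is the normalisation for which
  the differential below is an antiderivation.
\<close>

definition cochain_mult ::
  "('k::field_char_0 \<Rightarrow> 'a::{ring, monoid_mult} \<Rightarrow> 'a) \<Rightarrow> nat \<Rightarrow> nat \<Rightarrow>
   (('a \<Rightarrow> 'a) list \<Rightarrow> 'a) \<Rightarrow> (('a \<Rightarrow> 'a) list \<Rightarrow> 'a) \<Rightarrow> ('a \<Rightarrow> 'a) list \<Rightarrow> 'a"
  where "cochain_mult scale m n \<alpha> \<beta> = (\<lambda>Xs.
    if Xs \<in> Der_args scale (m + n)
    then scale (1 / (fact m * fact n))
      (\<Sum>\<sigma> | \<sigma> permutes {..<m + n}. scale (of_int (sign \<sigma>))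
         (\<alpha> (take m (permute_list \<sigma> Xs)) * \<beta> (drop m (permute_list \<sigma> Xs))))
    else 0)"

text \<open>
  Arguments are numbered from 0, and \<^term>\<open>nths Xs (- I)\<close> omits the arguments with index in
  \<^term>\<open>I\<close>.
\<close>

definition CE_d ::
  "('k::field \<Rightarrow> 'a::{ring, monoid_mult} \<Rightarrow> 'a) \<Rightarrow> nat \<Rightarrow>
   (('a \<Rightarrow> 'a) list \<Rightarrow> 'a) \<Rightarrow> ('a \<Rightarrow> 'a) list \<Rightarrow> 'a"
  where "CE_d scale n \<omega> = (\<lambda>Xs.
    if Xs \<in> Der_args scale (Suc n)
    then (\<Sum>i\<le>n. scale ((- 1) ^ i) ((Xs ! i) (\<omega> (nths Xs (- {i}))))) +
      (\<Sum>j\<le>n. \<Sum>i<j. scale ((- 1) ^ (i + j)) (\<omega> (lie (Xs ! i) (Xs ! j) # nths Xs (- {i, j}))))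
    else 0)"

text \<open>
  The smallest differential subalgebra of the cochains containing the algebra, as the least graded
  family containing the algebra and closed under the operations of a graded differential algebra.
  All its members are cochains, since these are closed under the same operations.
\<close>

inductive in_Omega_Der ::
  "('k::field_char_0 \<Rightarrow> 'a::{ring, monoid_mult} \<Rightarrow> 'a) \<Rightarrow> nat \<Rightarrow> (('a \<Rightarrow> 'a) list \<Rightarrow> 'a) \<Rightarrow> bool"
  for scale
  where
    algebra: "in_Omega_Der scale 0 (cochain0 a)"
  | zero: "in_Omega_Der scale n 0"
  | add: "in_Omega_Der scale n \<alpha> \<Longrightarrow> in_Omega_Der scale n \<beta> \<Longrightarrow> in_Omega_Der scale n (\<alpha> + \<beta>)"
  | scale: "in_Omega_Der scale n \<alpha> \<Longrightarrow> in_Omega_Der scale n (\<lambda>Xs. scale c (\<alpha> Xs))"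
  | mult: "in_Omega_Der scale m \<alpha> \<Longrightarrow> in_Omega_Der scale n \<beta> \<Longrightarrow>
      in_Omega_Der scale (m + n) (cochain_mult scale m n \<alpha> \<beta>)"
  | d: "in_Omega_Der scale n \<alpha> \<Longrightarrow> in_Omega_Der scale (Suc n) (CE_d scale n \<alpha>)"

definition Omega_Der ::
  "('k::field_char_0 \<Rightarrow> 'a::{ring, monoid_mult} \<Rightarrow> 'a) \<Rightarrow> nat \<Rightarrow> (('a \<Rightarrow> 'a) list \<Rightarrow> 'a) set"
  where "Omega_Der scale n = {\<omega>. in_Omega_Der scale n \<omega>}"

definition Omega_Der_underline ::
  "('k::field \<Rightarrow> 'a::{ring, monoid_mult} \<Rightarrow> 'a) \<Rightarrow> nat \<Rightarrow> (('a \<Rightarrow> 'a) list \<Rightarrow> 'a) set"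
  where "Omega_Der_underline scale n = {\<omega> \<in> cochains scale n.
    \<forall>Xs \<in> Der_args scale n. \<forall>i<n. \<forall>X \<in> Der scale. \<forall>z \<in> center.
      \<omega> (Xs[i := lmul z X]) = z * \<omega> (Xs[i := X])}"

text \<open>The evaluation of a 1-cochain, and the contraction with a derivation on a set of 1-cochains.\<close>

definition eval1 :: "(('a \<Rightarrow> 'a) list \<Rightarrow> 'a) \<Rightarrow> ('a \<Rightarrow> 'a) \<Rightarrow> 'a"
  where "eval1 \<omega> = (\<lambda>X. \<omega> [X])"

definition contraction ::
  "(('a \<Rightarrow> 'a) list \<Rightarrow> 'a::zero) set \<Rightarrow> ('a \<Rightarrow> 'a) \<Rightarrow> (('a \<Rightarrow> 'a) list \<Rightarrow> 'a) \<Rightarrow> 'a"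
  where "contraction M X = (\<lambda>\<omega>. if \<omega> \<in> M then \<omega> [X] else 0)"

end

theory Submission
  imports Defs
begin

text \<open>
  In degree one the smallest differential subalgebra is the bimodule spanned by the differentials of
  algebra elements, so a bimodule homomorphism \<open>\<mu>\<close> from it to the algebra is determined by
  \<open>a \<mapsto> \<mu> (d a)\<close>, which is a derivation by the Leibniz rule for \<open>d\<close>. In part (b), linearity over
  the center already contains linearity over the ground field, because scalar multiplication is
  multiplication by the central elements \<open>c 1\<close>; hence every element of the dual of the derivations
  is a cochain. The bidual is then computed by transporting the dual along the isomorphism of
  part (a).
\<close>

text \<open>Keeps the degree \<open>1\<close> from being rewritten to \<open>Suc 0\<close>, so that
  rules about \<open>Der_args scale 1\<close> still apply.\<close>

declare One_nat_def [simp del]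

subsection \<open>Modules of algebra-valued functions\<close>

lemma lmul_apply [simp]: "lmul a f x = a * f x"
  by (simp add: lmul_def)

lemma rmul_apply [simp]: "rmul f a x = f x * a"
  by (simp add: rmul_def)

lemma center_mult_commute: "z \<in> center \<Longrightarrow> z * a = a * z"
  by (simp add: center_def)

lemma center_mult_left_commute: "z \<in> center \<Longrightarrow> a * (z * b) = z * (a * b)"
  for z :: "'a::semigroup_mult"
  by (metis center_mult_commute mult.assoc)

text \<open>
  Both orientations are needed, since the simplifier applies permutative rules in one term order only.
\<close>
lemmas center_mult_ac = center_mult_left_commute center_mult_left_commute[symmetric]

lemma uminus_one_in_center: "- 1 \<in> (center :: 'a::{ring, monoid_mult} set)"
  by (simp add: center_def)

lemma uminus_eq_lmul: "- f = lmul (- 1) f"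
  for f :: "'x \<Rightarrow> 'a::{ring, monoid_mult}"
  by (simp add: fun_eq_iff)

text \<open>The module laws hold pointwise in the algebra, so only closure is at stake; closure
  under negation is closure under the action of the central element \<open>- 1\<close>.\<close>

lemma zmodule_functions:
  fixes N :: "('x \<Rightarrow> 'a::{ring, monoid_mult}) set"
  assumes "0 \<in> N"
    and "\<And>f g. f \<in> N \<Longrightarrow> g \<in> N \<Longrightarrow> f + g \<in> N"
    and "\<And>z f. z \<in> center \<Longrightarrow> f \<in> N \<Longrightarrow> lmul z f \<in> N"
  shows "zmodule N lmul"
  using assms
  by unfold_locales
    (simp_all add: fun_eq_iff algebra_simps uminus_eq_lmul uminus_one_in_center)

lemma bimodule_functions:
  fixes M :: "('x \<Rightarrow> 'a::{ring, monoid_mult}) set"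
  assumes "0 \<in> M"
    and "\<And>f g. f \<in> M \<Longrightarrow> g \<in> M \<Longrightarrow> f + g \<in> M"
    and "\<And>a f. f \<in> M \<Longrightarrow> lmul a f \<in> M"
    and "\<And>a f. f \<in> M \<Longrightarrow> rmul f a \<in> M"
  shows "bimodule M lmul rmul"
  using assms
  by unfold_locales (simp_all add: fun_eq_iff algebra_simps uminus_eq_lmul)

text \<open>Centrality of \<open>z\<close> gives
  \<open>z * (a * \<mu> m) = a * (z * \<mu> m)\<close>, which keeps \<open>lmul z \<mu>\<close> left
  linear.\<close>

lemma zmodule_bimodule_dual: "zmodule (bimodule_dual M l r) lmul"
  by (rule zmodule_functions)
    (auto simp: bimodule_dual_def bimodule_hom_def algebra_simps center_mult_ac)

text \<open>Here the whole algebra acts: linearity is only asked over central \<open>z\<close>, and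
  these move past any \<open>a\<close>.\<close>

lemma bimodule_zmodule_dual: "bimodule (zmodule_dual N act) lmul rmul"
  by (rule bimodule_functions)
    (auto simp: zmodule_dual_def zmodule_hom_def algebra_simps center_mult_ac)

section \<open>Isomorphisms and the transport of duals along them\<close>

lemma bimodule_iso_comp:
  assumes f: "bimodule_iso M l r M' l' r' f" and g: "bimodule_iso M' l' r' M'' l'' r'' g"
  shows "bimodule_iso M l r M'' l'' r'' (g \<circ> f)"
proof -
  have "f m \<in> M'" if "m \<in> M" for m
    using f that by (auto simp: bimodule_iso_def bimodule_hom_def)
  moreover have "bij_betw (g \<circ> f) M M''"
    using f g by (auto simp: bimodule_iso_def intro: bij_betw_trans)
  ultimately show ?thesis
    using f g by (auto simp: bimodule_iso_def bimodule_hom_def image_subset_iff)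
qed

lemma zmodule_hom_inv_into:
  assumes "zmodule_iso N act N' act' f"
  shows "zmodule_hom N' act' N act (inv_into N f)"
proof -
  have N: "zmodule N act" and inj: "inj_on f N" and im: "f ` N = N'"
    and hom: "zmodule_hom N act N' act' f"
    using assms by (auto simp: zmodule_iso_def bij_betw_def)
  let ?g = "inv_into N f"
  have g: "?g q \<in> N" "f (?g q) = q" if "q \<in> N'" for q
    using that im by (auto intro: inv_into_into f_inv_into_f)
  have "?g (p + q) = ?g p + ?g q" if "p \<in> N'" "q \<in> N'" for p q
  proof (rule inv_into_f_eq[OF inj])
    show "?g p + ?g q \<in> N"
      using that g by (blast intro: zmodule.add_closed[OF N])
    show "f (?g p + ?g q) = p + q"
      using hom g that by (simp add: zmodule_hom_def)
  qed
  moreover have "?g (act' z q) = act z (?g q)" if "z \<in> center" "q \<in> N'" for z q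
  proof (rule inv_into_f_eq[OF inj])
    show "act z (?g q) \<in> N"
      using that g by (blast intro: zmodule.act_closed[OF N])
    show "f (act z (?g q)) = act' z q"
      using hom g that by (simp add: zmodule_hom_def)
  qed
  ultimately show ?thesis
    using g by (auto simp: zmodule_hom_def)
qed

text \<open>The closure properties of \<open>P\<close> matter because \<open>pullback_on\<close> is
  cut off to 0 outside \<open>P\<close>: the laws at \<open>p + q\<close> and
  \<open>actp z p\<close> need these elements to lie in \<open>P\<close>.\<close>

lemma pullback_on_mem_zmodule_dual:
  assumes "zmodule P actp" "zmodule_hom P actp N act g" "\<nu> \<in> zmodule_dual N act"
  shows "pullback_on P g \<nu> \<in> zmodule_dual P actp"
  using assms(2,3) zmodule.add_closed[OF assms(1)] zmodule.act_closed[OF assms(1)]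
  by (auto simp: zmodule_dual_def zmodule_hom_def pullback_on_def image_subset_iff)

text \<open>Dualizing reverses arrows, so the inverse of \<open>f\<close> induces a map in the
  direction of \<open>f\<close>; pullback along \<open>f\<close> undoes it. Outside the modules both
  composites give 0, as the normalised duals demand.\<close>

lemma bimodule_iso_pullback_on_inv:
  assumes iso: "zmodule_iso N act N' act' f"
  shows "bimodule_iso (zmodule_dual N act) lmul rmul (zmodule_dual N' act') lmul rmul
    (pullback_on N' (inv_into N f))"
proof -
  let ?g = "inv_into N f"
  have N: "zmodule N act" and N': "zmodule N' act'" and hom: "zmodule_hom N act N' act' f"
    and inj: "inj_on f N" and im: "f ` N = N'"
    using iso by (auto simp: zmodule_iso_def bij_betw_def)
  have ghom: "zmodule_hom N' act' N act ?g"
    using iso by (rule zmodule_hom_inv_into)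
  have "bij_betw (pullback_on N' ?g) (zmodule_dual N act) (zmodule_dual N' act')"
  proof (rule bij_betw_byWitness[where f' = "pullback_on N f"])
    show "\<forall>\<nu>\<in>zmodule_dual N act. pullback_on N f (pullback_on N' ?g \<nu>) = \<nu>"
      using im inj by (auto simp: pullback_on_def zmodule_dual_def fun_eq_iff)
    show "\<forall>\<nu>\<in>zmodule_dual N' act'. pullback_on N' ?g (pullback_on N f \<nu>) = \<nu>"
      using im inj
      by (auto simp: pullback_on_def zmodule_dual_def fun_eq_iff)
  qed (auto intro: pullback_on_mem_zmodule_dual[OF N' ghom] pullback_on_mem_zmodule_dual[OF N hom])
  then show ?thesis
    using pullback_on_mem_zmodule_dual[OF N' ghom]
    by (auto simp: bimodule_iso_def bimodule_hom_def bimodule_zmodule_dual pullback_on_def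
        fun_eq_iff)
qed

subsection \<open>Derivations and forms of degree one\<close>

lemma Der_iff:
  assumes "unital_algebra scale"
  shows "X \<in> Der scale \<longleftrightarrow>
    (\<forall>a b. X (a + b) = X a + X b) \<and> (\<forall>c a. X (scale c a) = scale c (X a)) \<and>
    (\<forall>a b. X (a * b) = X a * b + a * X b)"
proof -
  interpret unital_algebra scale by fact
  show ?thesis
    by (auto simp: Der_def Vector_Spaces.linear_iff intro: vector_space_axioms)
qed

lemma scale_eq_mult_left:
  assumes "unital_algebra scale"
  shows "scale c a = scale c 1 * a"
  using unital_algebra.scale_mult_left[OF assms, of c 1 a] by simp

lemma scale_one_in_center:
  assumes "unital_algebra scale"
  shows "scale c 1 \<in> center"
proof -
  interpret unital_algebra scale by fact
  have "scale c 1 * a = a * scale c 1" for a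
    by (simp flip: scale_mult_left scale_mult_right)
  then show ?thesis
    by (simp add: center_def)
qed

text \<open>Turns closure or linearity under the left action into the same property for
  scalars.\<close>

lemma scale_eq_lmul:
  assumes "unital_algebra scale"
  shows "(\<lambda>x. scale c (f x)) = lmul (scale c 1) f"
  unfolding fun_eq_iff lmul_apply by (intro allI scale_eq_mult_left[OF assms])

text \<open>The Leibniz rule for \<open>lmul z X\<close> needs
  \<open>z * (a * X b) = a * (z * X b)\<close>, hence central \<open>z\<close>.\<close>

lemma zmodule_Der:
  assumes "unital_algebra scale"
  shows "zmodule (Der scale) lmul"
proof -
  interpret unital_algebra scale by fact
  show ?thesis
    by (rule zmodule_functions)
      (auto simp: Der_iff[OF assms] algebra_simps scale_mult_right center_mult_ac)
qed

section \<open>One-forms linear over the center\<close>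

lemma Der_args_1: "Der_args scale 1 = (\<lambda>X. [X]) ` Der scale"
  by (auto simp: Der_args_def length_Suc_conv One_nat_def)

text \<open>In degree one this makes antisymmetry trivial and leaves a single summand in
  \<open>cochain_mult\<close>.\<close>

lemma permutes_lessThan_1: "\<sigma> permutes {..<1::nat} \<longleftrightarrow> \<sigma> = id"
  by (simp add: One_nat_def lessThan_Suc permutes_sing)

text \<open>A cochain of degree one is a function of one derivation wrapped in a list. The two
  conventions of vanishing outside the domain match, since \<open>[X]\<close> is an admissible list
  exactly when \<open>X\<close> is a derivation.\<close>

lemma Omega_Der_underline_1_iff:
  assumes "unital_algebra scale"
  shows "\<omega> \<in> Omega_Der_underline scale 1 \<longleftrightarrow>
    (\<forall>Xs. Xs \<notin> Der_args scale 1 \<longrightarrow> \<omega> Xs = 0) \<and> eval1 \<omega> \<in> zmodule_dual (Der scale) lmul"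
    (is "?L \<longleftrightarrow> ?R")
proof -
  interpret unital_algebra scale by fact
  have D: "?L \<longleftrightarrow> (\<forall>Xs. Xs \<notin> Der_args scale 1 \<longrightarrow> \<omega> Xs = 0) \<and>
    (\<forall>X\<in>Der scale. \<forall>Y\<in>Der scale. \<omega> [X + Y] = \<omega> [X] + \<omega> [Y]) \<and>
    (\<forall>X\<in>Der scale. \<forall>c. \<omega> [\<lambda>a. scale c (X a)] = scale c (\<omega> [X])) \<and>
    (\<forall>z\<in>center. \<forall>X\<in>Der scale. \<omega> [lmul z X] = z * \<omega> [X])"
    unfolding Omega_Der_underline_def cochains_def Der_args_1 permutes_lessThan_1 less_one
    by simp blast
  have scale_linear: "\<omega> [\<lambda>a. scale c (X a)] = scale c (\<omega> [X])"
    if "\<forall>z\<in>center. \<forall>X\<in>Der scale. \<omega> [lmul z X] = z * \<omega> [X]" "X \<in> Der scale" for c X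
  proof -
    have "\<omega> [\<lambda>a. scale c (X a)] = scale c 1 * \<omega> [X]"
      unfolding scale_eq_lmul[OF assms, of c X]
      using that scale_one_in_center[OF assms] by blast
    then show ?thesis
      by (simp flip: scale_mult_left)
  qed
  have vanish: "\<omega> [X] = 0"
    if "\<forall>Xs. Xs \<notin> Der_args scale 1 \<longrightarrow> \<omega> Xs = 0" "X \<notin> Der scale" for X
    using that by (auto simp: Der_args_1)
  show ?thesis
    unfolding D eval1_def zmodule_dual_def zmodule_hom_def mem_Collect_eq
    using vanish by (auto simp only: scale_linear)
qed

lemma bimodule_Omega_Der_underline_1:
  assumes "unital_algebra scale"
  shows "bimodule (Omega_Der_underline scale 1) lmul rmul"
  by (rule bimodule_functions; unfold Omega_Der_underline_1_iff[OF assms])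
    (auto simp: eval1_def zmodule_dual_def zmodule_hom_def algebra_simps center_mult_ac)

lemma bimodule_iso_eval1:
  assumes "unital_algebra scale"
  shows "bimodule_iso (Omega_Der_underline scale 1) lmul rmul
    (zmodule_dual (Der scale) lmul) lmul rmul eval1"
proof -
  let ?W = "Omega_Der_underline scale 1" and ?D = "zmodule_dual (Der scale) lmul"
  have "bij_betw eval1 ?W ?D"
  \<comment> \<open>The inverse feeds the only entry of an admissible list to \<open>\<nu>\<close>;
    the guard sets all other lists, including the empty one, to 0.\<close>
  proof (rule bij_betw_byWitness
      [where f' = "\<lambda>\<nu> Xs. if Xs \<in> Der_args scale 1 then \<nu> (hd Xs) else 0"])
    show "\<forall>\<omega>\<in>?W. (\<lambda>Xs. if Xs \<in> Der_args scale 1 then eval1 \<omega> (hd Xs) else 0) = \<omega>"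
      by (auto simp: Omega_Der_underline_1_iff[OF assms] eval1_def Der_args_1 fun_eq_iff)
    show eval: "\<forall>\<nu>\<in>?D. eval1 (\<lambda>Xs. if Xs \<in> Der_args scale 1 then \<nu> (hd Xs) else 0) = \<nu>"
      by (auto simp: eval1_def zmodule_dual_def Der_args_1 fun_eq_iff image_iff)
    show "eval1 ` ?W \<subseteq> ?D"
      by (auto simp: Omega_Der_underline_1_iff[OF assms])
    show "(\<lambda>\<nu> Xs. if Xs \<in> Der_args scale 1 then \<nu> (hd Xs) else 0) ` ?D \<subseteq> ?W"
      using eval by (auto simp: Omega_Der_underline_1_iff[OF assms])
  qed
  then show ?thesis
    by (auto simp: bimodule_iso_def bimodule_hom_def bimodule_zmodule_dual
        bimodule_Omega_Der_underline_1[OF assms] Omega_Der_underline_1_iff[OF assms])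
      (auto simp: eval1_def fun_eq_iff)
qed

section \<open>The differential algebra in degrees zero and one\<close>

lemma CE_d_cochain0:
  assumes "unital_algebra scale"
  shows "CE_d scale 0 (cochain0 a) = (\<lambda>Xs. if Xs \<in> Der_args scale 1 then hd Xs a else 0)"
proof -
  interpret unital_algebra scale by fact
  show ?thesis
    \<comment> \<open>In degree 0 the double sum over \<open>i < j\<close> is empty, and deleting
      the only argument leaves the empty list, on which \<open>cochain0 a\<close> is
      \<open>a\<close>.\<close>
    by (auto simp: CE_d_def fun_eq_iff Der_args_1 cochain0_def nths_singleton
        simp flip: One_nat_def)
qed

lemma CE_d_cochain0_in_underline:
  assumes "unital_algebra scale"
  shows "CE_d scale 0 (cochain0 a) \<in> Omega_Der_underline scale 1"
  unfolding Omega_Der_underline_1_iff[OF assms] CE_d_cochain0[OF assms]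
  using zmodule.add_closed[OF zmodule_Der[OF assms]] zmodule.act_closed[OF zmodule_Der[OF assms]]
  by (auto simp: eval1_def Der_args_1 zmodule_dual_def zmodule_hom_def image_iff)

text \<open>Products with degree 0 elements realise the bimodule actions. The hypothesis on
  \<open>\<omega>\<close> makes it vanish off \<open>Der_args scale 1\<close>, where the product is
  0 by definition.\<close>

lemma cochain_mult_cochain0_left:
  assumes "unital_algebra scale" and "\<omega> \<in> Omega_Der_underline scale 1"
  shows "cochain_mult scale 0 1 (cochain0 a) \<omega> = lmul a \<omega>"
proof
  interpret unital_algebra scale by fact
  show "cochain_mult scale 0 1 (cochain0 a) \<omega> Xs = lmul a \<omega> Xs" for Xs
    using assms(2)
    by (simp add: cochain_mult_def permutes_lessThan_1 cochain0_def
        Omega_Der_underline_1_iff[OF assms(1)])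
qed

lemma cochain_mult_cochain0_right:
  assumes "unital_algebra scale" and "\<omega> \<in> Omega_Der_underline scale 1"
  shows "cochain_mult scale 1 0 \<omega> (cochain0 a) = rmul \<omega> a"
proof
  interpret unital_algebra scale by fact
  show "cochain_mult scale 1 0 \<omega> (cochain0 a) Xs = rmul \<omega> a Xs" for Xs
    using assms(2)
    by (auto simp: cochain_mult_def permutes_lessThan_1 cochain0_def
        Omega_Der_underline_1_iff[OF assms(1)] Der_args_1)
qed

lemma cochain_mult_cochain0:
  assumes "unital_algebra scale"
  shows "cochain_mult scale 0 0 (cochain0 a) (cochain0 b) = cochain0 (a * b)"
proof
  interpret unital_algebra scale by fact
  show "cochain_mult scale 0 0 (cochain0 a) (cochain0 b) Xs = cochain0 (a * b) Xs" for Xs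
    by (auto simp: cochain_mult_def cochain0_def Der_args_def)
qed

text \<open>Both degrees go into one induction: a form of degree one arises by multiplying with
  degree 0 or by differentiating degree 0. No operation lowers the degree, so higher forms cannot
  contribute.\<close>

lemma in_Omega_Der_low_degree:
  assumes alg: "unital_algebra scale"
    and N: "bimodule N lmul rmul" "N \<subseteq> Omega_Der_underline scale 1"
      "\<And>a. CE_d scale 0 (cochain0 a) \<in> N"
    and "in_Omega_Der scale n \<alpha>"
  shows "(n = 0 \<longrightarrow> \<alpha> \<in> range cochain0) \<and> (n = 1 \<longrightarrow> \<alpha> \<in> N)"
  using assms(5)
proof induction
  case (zero n)
  have "0 = cochain0 0"
    by (simp add: cochain0_def fun_eq_iff)
  then show ?case
    using bimodule.zero_closed[OF N(1)] by blast
next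
  case (add n \<alpha> \<beta>)
  have "cochain0 a + cochain0 b \<in> range cochain0" for a b :: 'b
    by (rule range_eqI[where x = "a + b"]) (simp add: cochain0_def fun_eq_iff)
  with add show ?case
    using bimodule.add_closed[OF N(1)] by blast
next
  case (scale n \<alpha> c)
  have "lmul b (cochain0 a) \<in> range cochain0" for a b :: 'b
    by (rule range_eqI[where x = "b * a"]) (simp add: cochain0_def fun_eq_iff)
  with scale show ?case
    unfolding scale_eq_lmul[OF alg, of c \<alpha>]
    using bimodule.l_closed[OF N(1)] by blast
next
  case (mult m \<alpha> n \<beta>)
  \<comment> \<open>Total degree one forces one factor of degree 0; beyond degree one nothing is
    claimed.\<close>
  consider "m = 0" "n = 0" | "m = 0" "n = 1" | "m = 1" "n = 0" | "m + n > 1"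
    by linarith
  then show ?case
  proof cases
    case 1
    then show ?thesis
      using mult by (auto simp: cochain_mult_cochain0[OF alg])
  next
    case 2
    with mult obtain a where "\<alpha> = cochain0 a" "\<beta> \<in> N"
      by auto
    with 2 show ?thesis
      using cochain_mult_cochain0_left[OF alg] N(2) bimodule.l_closed[OF N(1)] by auto
  next
    case 3
    with mult obtain a where "\<beta> = cochain0 a" "\<alpha> \<in> N"
      by auto
    with 3 show ?thesis
      using cochain_mult_cochain0_right[OF alg] N(2) bimodule.r_closed[OF N(1)] by auto
  qed auto
next
  case (d n \<alpha>)
  then show ?case
    using N(3) by (auto simp: One_nat_def)
qed auto

text \<open>Serves as an induction principle for one-forms: a property passes from the differentials
  to all of them once it cuts out a bimodule.\<close>

lemma Omega_Der_1_least:
  assumes "unital_algebra scale"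
    and "bimodule N lmul rmul" "N \<subseteq> Omega_Der_underline scale 1"
      "\<And>a. CE_d scale 0 (cochain0 a) \<in> N"
  shows "Omega_Der scale 1 \<subseteq> N"
  using in_Omega_Der_low_degree[OF assms, of 1] by (auto simp: Omega_Der_def)

lemma Omega_Der_1_subset_underline:
  assumes "unital_algebra scale"
  shows "Omega_Der scale 1 \<subseteq> Omega_Der_underline scale 1"
  using assms bimodule_Omega_Der_underline_1[OF assms] order_refl CE_d_cochain0_in_underline[OF assms]
  by (rule Omega_Der_1_least)

lemma CE_d_cochain0_in_Omega_Der: "CE_d scale 0 (cochain0 a) \<in> Omega_Der scale 1"
  using in_Omega_Der.d[OF in_Omega_Der.algebra] by (simp add: Omega_Der_def One_nat_def)

lemma bimodule_Omega_Der_1: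
  assumes "unital_algebra scale"
  shows "bimodule (Omega_Der scale 1) lmul rmul"
proof (rule bimodule_functions)
  fix a \<omega> assume \<omega>: "\<omega> \<in> Omega_Der scale 1"
  then have \<omega>': "in_Omega_Der scale 1 \<omega>" "\<omega> \<in> Omega_Der_underline scale 1"
    using Omega_Der_1_subset_underline[OF assms] by (auto simp: Omega_Der_def)
  show "lmul a \<omega> \<in> Omega_Der scale 1"
    using in_Omega_Der.mult[OF in_Omega_Der.algebra \<omega>'(1), of a]
    by (simp add: Omega_Der_def cochain_mult_cochain0_left[OF assms \<omega>'(2)])
  show "rmul \<omega> a \<in> Omega_Der scale 1"
    using in_Omega_Der.mult[OF \<omega>'(1) in_Omega_Der.algebra, of a]
    by (simp add: Omega_Der_def cochain_mult_cochain0_right[OF assms \<omega>'(2)])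
qed (auto simp: Omega_Der_def intro: in_Omega_Der.zero in_Omega_Der.add)

section \<open>The pairing with derivations and the dual of the generated one-forms\<close>

lemma separated_duality_eval1:
  assumes alg: "unital_algebra scale" and M: "bimodule M lmul rmul"
    and sub: "M \<subseteq> Omega_Der_underline scale 1"
    and d: "\<And>a. CE_d scale 0 (cochain0 a) \<in> M"
  shows "separated_duality M lmul rmul (Der scale) lmul eval1"
proof -
  interpret bimodule M lmul rmul by fact
  interpret N: zmodule "Der scale" lmul by (rule zmodule_Der[OF alg])
  have dual: "eval1 \<omega> \<in> zmodule_dual (Der scale) lmul"
    and vanish: "\<And>Xs. Xs \<notin> Der_args scale 1 \<Longrightarrow> \<omega> Xs = 0" if "\<omega> \<in> M" for \<omega>
    using that sub by (auto simp: Omega_Der_underline_1_iff[OF alg])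
  show ?thesis
  proof unfold_locales
    fix z :: 'b and \<omega> assume z: "z \<in> center" and \<omega>: "\<omega> \<in> M"
    show "lmul z \<omega> = rmul \<omega> z"
      by (rule ext) (simp add: center_mult_commute[OF z])
    fix X assume X: "X \<in> Der scale"
    show "eval1 (rmul \<omega> z) X = eval1 \<omega> (lmul z X)"
      using dual[OF \<omega>] z X
      by (simp add: zmodule_dual_def zmodule_hom_def eval1_def center_mult_commute[OF z])
  next
    fix \<omega> X Y assume "\<omega> \<in> M" "X \<in> Der scale" "Y \<in> Der scale"
    then show "eval1 \<omega> (X + Y) = eval1 \<omega> X + eval1 \<omega> Y"
      using dual by (simp add: zmodule_dual_def zmodule_hom_def)
  next
    fix \<omega> assume "\<omega> \<in> M" "\<And>X. X \<in> Der scale \<Longrightarrow> eval1 \<omega> X = 0"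
    then have "\<omega> Xs = 0" for Xs
      using vanish by (cases "Xs \<in> Der_args scale 1") (auto simp: Der_args_1 eval1_def)
    then show "\<omega> = 0"
      by (simp add: fun_eq_iff)
  next
    fix X assume X: "X \<in> Der scale" and 0: "\<And>\<omega>. \<omega> \<in> M \<Longrightarrow> eval1 \<omega> X = 0"
    \<comment> \<open>The pairing of \<open>X\<close> with the differential of \<open>a\<close> is
      \<open>X a\<close>, so the differentials alone separate derivations.\<close>
    have "X a = 0" for a
      using 0[OF d, of a] X by (auto simp: CE_d_cochain0[OF alg] Der_args_1 eval1_def split: if_splits)
    then show "X = 0"
      by (simp add: fun_eq_iff)
  qed (simp_all add: eval1_def)
qed

lemma contraction_mem_dual:
  assumes "duality M lmul rmul N lmul eval1" "X \<in> N"
  shows "contraction M X \<in> bimodule_dual M lmul rmul"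
proof -
  interpret duality M lmul rmul N lmul eval1 by fact
  show ?thesis
    using M.add_closed M.l_closed M.r_closed
    by (auto simp: bimodule_dual_def bimodule_hom_def contraction_def)
qed

lemma bimodule_dual_Omega_Der_1_subset:
  assumes alg: "unital_algebra scale"
  shows "bimodule_dual (Omega_Der scale 1) lmul rmul \<subseteq>
    contraction (Omega_Der scale 1) ` Der scale"
proof
  interpret unital_algebra scale by fact
  let ?M = "Omega_Der scale 1"
  let ?d = "\<lambda>a. CE_d scale 0 (cochain0 a)"
  interpret M: bimodule ?M lmul rmul
    by (rule bimodule_Omega_Der_1[OF alg])
  fix \<mu> assume \<mu>: "\<mu> \<in> bimodule_dual ?M lmul rmul"
  \<comment> \<open>The only possible choice, as contraction with \<open>X\<close> sends the
    differential of \<open>a\<close> to \<open>X a\<close>.\<close>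
  define X where "X a = \<mu> (?d a)" for a
  have \<mu>_add: "\<mu> (\<alpha> + \<beta>) = \<mu> \<alpha> + \<mu> \<beta>" if "\<alpha> \<in> ?M" "\<beta> \<in> ?M" for \<alpha> \<beta>
    using \<mu> that by (auto simp: bimodule_dual_def bimodule_hom_def)
  have \<mu>_l: "\<mu> (lmul a \<alpha>) = a * \<mu> \<alpha>" and \<mu>_r: "\<mu> (rmul \<alpha> a) = \<mu> \<alpha> * a" if "\<alpha> \<in> ?M" for \<alpha> a
    using \<mu> that by (auto simp: bimodule_dual_def bimodule_hom_def)
  have \<mu>_out: "\<mu> \<alpha> = 0" if "\<alpha> \<notin> ?M" for \<alpha>
    using \<mu> that by (auto simp: bimodule_dual_def)
  have \<mu>_0: "\<mu> 0 = 0"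
    using \<mu>_add[OF M.zero_closed M.zero_closed] by simp
  note d_mem = CE_d_cochain0_in_Omega_Der
  have d_add: "?d (a + b) = ?d a + ?d b" for a b
    by (auto simp: CE_d_cochain0[OF alg] fun_eq_iff Der_args_1 Der_iff[OF alg])
  \<comment> \<open>Since \<open>\<mu>\<close> is only known to respect the bimodule actions, the
    scalar is written as the algebra element \<open>scale c 1\<close>.\<close>
  have d_scale: "?d (scale c a) = lmul (scale c 1) (?d a)" for c a
    by (auto simp: CE_d_cochain0[OF alg] fun_eq_iff Der_args_1 Der_iff[OF alg]
        simp flip: scale_mult_left)
  have d_mult: "?d (a * b) = rmul (?d a) b + lmul a (?d b)" for a b
    by (auto simp: CE_d_cochain0[OF alg] fun_eq_iff Der_args_1 Der_iff[OF alg])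
  have "X (a + b) = X a + X b" for a b
    unfolding X_def d_add by (intro \<mu>_add d_mem)
  moreover have "X (scale c a) = scale c (X a)" for c a
    unfolding X_def d_scale \<mu>_l[OF d_mem] by (simp flip: scale_mult_left)
  moreover have "X (a * b) = X a * b + a * X b" for a b
    unfolding X_def d_mult
    by (simp only: \<mu>_add \<mu>_l \<mu>_r d_mem M.l_closed M.r_closed)
  ultimately have X: "X \<in> Der scale"
    by (simp add: Der_iff[OF alg])
  \<comment> \<open>The forms on which \<open>\<mu>\<close> agrees with evaluation at
    \<open>X\<close> form a bimodule containing the differentials, hence are all of
    \<open>?M\<close>.\<close>
  have "?M \<subseteq> {\<omega> \<in> ?M. \<mu> \<omega> = \<omega> [X]}"
  proof (rule Omega_Der_1_least[OF alg])
    show "bimodule {\<omega> \<in> ?M. \<mu> \<omega> = \<omega> [X]} lmul rmul"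
      by (rule bimodule_functions)
        (simp_all only: mem_Collect_eq M.zero_closed M.add_closed M.l_closed M.r_closed
          \<mu>_0 \<mu>_add \<mu>_l \<mu>_r plus_fun_apply zero_fun_apply lmul_apply rmul_apply simp_thms)
    show "{\<omega> \<in> ?M. \<mu> \<omega> = \<omega> [X]} \<subseteq> Omega_Der_underline scale 1"
      using Omega_Der_1_subset_underline[OF alg] by blast
    show "?d a \<in> {\<omega> \<in> ?M. \<mu> \<omega> = \<omega> [X]}" for a
    proof -
      have "?d a [X] = X a"
        using X by (simp add: CE_d_cochain0[OF alg] Der_args_1)
      then show ?thesis
        using d_mem by (simp add: X_def)
    qed
  qed
  then have "\<mu> = contraction ?M X"
    by (auto simp: contraction_def fun_eq_iff \<mu>_out)
  with X show "\<mu> \<in> contraction ?M ` Der scale"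
    by blast
qed

lemma zmodule_iso_contraction:
  assumes alg: "unital_algebra scale"
    and sep: "separated_duality (Omega_Der scale 1) lmul rmul (Der scale) lmul eval1"
  shows "zmodule_iso (Der scale) lmul
    (bimodule_dual (Omega_Der scale 1) lmul rmul) lmul
    (contraction (Omega_Der scale 1))"
proof -
  let ?M = "Omega_Der scale 1"
  interpret separated_duality ?M lmul rmul "Der scale" lmul eval1 by fact
  have mem: "contraction ?M X \<in> bimodule_dual ?M lmul rmul" if "X \<in> Der scale" for X
    using duality_axioms that by (rule contraction_mem_dual)
  have "inj_on (contraction ?M) (Der scale)"
  proof (rule inj_onI, rule ext)
    fix X Y a
    assume XY: "X \<in> Der scale" "Y \<in> Der scale" "contraction ?M X = contraction ?M Y"
    show "X a = Y a"
      using fun_cong[OF XY(3), of "CE_d scale 0 (cochain0 a)"] XY(1,2)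
      by (simp add: contraction_def CE_d_cochain0_in_Omega_Der)
        (simp add: CE_d_cochain0[OF alg] Der_args_1)
  qed
  moreover have "contraction ?M ` Der scale = bimodule_dual ?M lmul rmul"
    using mem bimodule_dual_Omega_Der_1_subset[OF alg] by blast
  moreover have "zmodule_hom (Der scale) lmul (bimodule_dual ?M lmul rmul) lmul (contraction ?M)"
    unfolding zmodule_hom_def
  proof (intro conjI ballI)
    show "contraction ?M ` Der scale \<subseteq> bimodule_dual ?M lmul rmul"
      using mem by blast
    show "contraction ?M (X + Y) = contraction ?M X + contraction ?M Y"
      if "X \<in> Der scale" "Y \<in> Der scale" for X Y
      using add_right that by (simp add: contraction_def fun_eq_iff eval1_def)
    show "contraction ?M (lmul z X) = lmul z (contraction ?M X)"
      if "z \<in> center" "X \<in> Der scale" for z X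
      \<comment> \<open>\<open>balanced\<close> puts \<open>z\<close> on the right of the value;
        centrality moves it to the left.\<close>
      using balanced[OF that(1) _ that(2)]
      by (simp add: contraction_def fun_eq_iff eval1_def center_mult_commute[OF that(1)])
  qed
  ultimately show ?thesis
    by (simp add: zmodule_iso_def bij_betw_def zmodule_bimodule_dual zmodule_Der[OF alg])
qed

theorem theorem1:
  fixes scale :: "'k::real_or_complex \<Rightarrow> 'a::{ring, monoid_mult} \<Rightarrow> 'a"
  assumes "unital_algebra scale"
  shows
    "zmodule_iso (Der scale) lmul
       (bimodule_dual (Omega_Der scale 1) lmul rmul) lmul
       (contraction (Omega_Der scale 1)) \<and>
     separated_duality (Omega_Der scale 1) lmul rmul (Der scale) lmul eval1 \<and>
     bimodule_iso (Omega_Der_underline scale 1) lmul rmul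
       (zmodule_dual (Der scale) lmul) lmul rmul
       eval1 \<and>
     separated_duality (Omega_Der_underline scale 1) lmul rmul (Der scale) lmul eval1 \<and>
     bimodule_iso (Omega_Der_underline scale 1) lmul rmul
       (zmodule_dual (bimodule_dual (Omega_Der scale 1) lmul rmul) lmul) lmul rmul
       (pullback_on (bimodule_dual (Omega_Der scale 1) lmul rmul)
          (inv_into (Der scale) (contraction (Omega_Der scale 1))) \<circ> eval1)"
proof -
  have sep: "separated_duality (Omega_Der scale 1) lmul rmul (Der scale) lmul eval1"
    using assms bimodule_Omega_Der_1[OF assms] Omega_Der_1_subset_underline[OF assms]
      CE_d_cochain0_in_Omega_Der
    by (rule separated_duality_eval1)
  have sep_underline:
    "separated_duality (Omega_Der_underline scale 1) lmul rmul (Der scale) lmul eval1"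
    using assms bimodule_Omega_Der_underline_1[OF assms] order_refl
      CE_d_cochain0_in_underline[OF assms]
    by (rule separated_duality_eval1)
  note iso = zmodule_iso_contraction[OF assms sep]
  show ?thesis
    using iso sep bimodule_iso_eval1[OF assms] sep_underline
      bimodule_iso_comp[OF bimodule_iso_eval1[OF assms] bimodule_iso_pullback_on_inv[OF iso]]
    by blast
qed

end
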